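(* Let $\mu,\mu'$ be probability measures on $\mathbb Z$ with supports $S_\mu\subset\mathbb Z^+$, $S_{\mu'}\subset\mathbb Z^-$ and $\gcd(S_\mu)=\gcd(S_{\mu'})=1$, and let $\xi_1,\xi_1'$ have laws $\mu,\mu'$. Assume that $\mathbb E[\xi_1^p]<+\infty$ and $\mathbb E[(-\xi_1')^q]<+\infty$ for some $p,q\in\,]0,1[$ with $p+q=1$. Then $$\sum_{n=0}^{+\infty}\mu\,]n,+\infty[\;\mu'\,]-\infty,-n[\;<+\infty,$$ and the Markov chain $\mathcal X^{(0)}(\mu,\mu')$ is recurrent on its unique essential class (and positive recurrent when $\mathbb E[\xi_1]<+\infty$ and $\mathbb E[-\xi_1']<+\infty$).
   Context: $\mathbb Z^+$ (resp. $\mathbb Z^-$) is the set of positive (resp. negative) integers. The oscillating random walk $\mathcal X^{(0)}(\mu,\mu')=(X_n^{(0)})_{n\ge0}$ is the Markov chain on $\mathbb Z$ with $X_{n+1}^{(0)}=X_n^{(0)}+\xi_{n+1}$ if $X_n^{(0)}\le-1$ and $X_{n+1}^{(0)}=X_n^{(0)}+\xi'_{n+1}$ if $X_n^{(0)}\ge0$, where $(\xi_n,\xi_n')_{n\ge1}$ is i.i.d., $\xi_n$ has law $\mu$ and $\xi'_n$ has law $\mu'$. An essential class is a closed irreducible (communicating) class; under the present assumptions there is exactly one, and it contains $0$. *)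

theory Defs
  imports "HOL-Probability.Probability"
begin

text \<open>
  The i.i.d. sequence driving the walk, indexed by \<open>n \<ge> 1\<close>. Independence and equidistribution
  are those of the pairs \<open>(\<xi> n, \<xi>' n)\<close>; the two components of one pair may be dependent.
\<close>

definition iid_steps ::
  "'w measure \<Rightarrow> int pmf \<Rightarrow> int pmf \<Rightarrow> (nat \<Rightarrow> 'w \<Rightarrow> int) \<Rightarrow> (nat \<Rightarrow> 'w \<Rightarrow> int) \<Rightarrow> bool" where
  "iid_steps M \<mu> \<mu>' \<xi> \<xi>' \<longleftrightarrow>
     prob_space M \<and>
     prob_space.indep_vars M (\<lambda>_. count_space UNIV) (\<lambda>n \<omega>. (\<xi> n \<omega>, \<xi>' n \<omega>)) {1..} \<and>
     (\<forall>n\<ge>1. distr M (count_space UNIV) (\<lambda>\<omega>. (\<xi> n \<omega>, \<xi>' n \<omega>)) =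
             distr M (count_space UNIV) (\<lambda>\<omega>. (\<xi> 1 \<omega>, \<xi>' 1 \<omega>))) \<and>
     distr M (count_space UNIV) (\<xi> 1) = measure_pmf \<mu> \<and>
     distr M (count_space UNIV) (\<xi>' 1) = measure_pmf \<mu>'"

primrec osc_walk ::
  "(nat \<Rightarrow> 'w \<Rightarrow> int) \<Rightarrow> (nat \<Rightarrow> 'w \<Rightarrow> int) \<Rightarrow> int \<Rightarrow> nat \<Rightarrow> 'w \<Rightarrow> int" where
  "osc_walk \<xi> \<xi>' x 0 \<omega> = x"
| "osc_walk \<xi> \<xi>' x (Suc n) \<omega> =
     (if osc_walk \<xi> \<xi>' x n \<omega> \<le> -1
      then osc_walk \<xi> \<xi>' x n \<omega> + \<xi> (Suc n) \<omega>
      else osc_walk \<xi> \<xi>' x n \<omega> + \<xi>' (Suc n) \<omega>)"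

text \<open>
  Below, \<open>X x n\<close> is the position at time \<open>n\<close> of a Markov chain started at \<open>x\<close>. All starting
  points share the probability space \<open>M\<close>, so that the law under which the chain starts at \<open>x\<close> is
  the law of \<open>X x\<close> under \<open>M\<close>.
\<close>

definition accessible ::
  "'w measure \<Rightarrow> ('s \<Rightarrow> nat \<Rightarrow> 'w \<Rightarrow> 's) \<Rightarrow> 's \<Rightarrow> 's \<Rightarrow> bool" where
  "accessible M X x y \<longleftrightarrow> (\<exists>n. measure M {\<omega> \<in> space M. X x n \<omega> = y} > 0)"

definition essential_class ::
  "'w measure \<Rightarrow> ('s \<Rightarrow> nat \<Rightarrow> 'w \<Rightarrow> 's) \<Rightarrow> 's set \<Rightarrow> bool" where
  "essential_class M X C \<longleftrightarrow>
     C \<noteq> {} \<and>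
     (\<forall>x\<in>C. \<forall>y\<in>C. accessible M X x y) \<and>
     (\<forall>x\<in>C. \<forall>y. accessible M X x y \<longrightarrow> y \<in> C)"

text \<open>The infimum is \<open>\<infinity>\<close> on paths that never return.\<close>

definition return_time :: "('s \<Rightarrow> nat \<Rightarrow> 'w \<Rightarrow> 's) \<Rightarrow> 's \<Rightarrow> 'w \<Rightarrow> enat" where
  "return_time X x \<omega> = Inf {enat n | n. n \<ge> 1 \<and> X x n \<omega> = x}"

definition recurrent_on ::
  "'w measure \<Rightarrow> ('s \<Rightarrow> nat \<Rightarrow> 'w \<Rightarrow> 's) \<Rightarrow> 's set \<Rightarrow> bool" where
  "recurrent_on M X C \<longleftrightarrow> (\<forall>x\<in>C. AE \<omega> in M. return_time X x \<omega> < \<infinity>)"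

definition positive_recurrent_on ::
  "'w measure \<Rightarrow> ('s \<Rightarrow> nat \<Rightarrow> 'w \<Rightarrow> 's) \<Rightarrow> 's set \<Rightarrow> bool" where
  "positive_recurrent_on M X C \<longleftrightarrow>
     (\<forall>x\<in>C. (\<integral>\<^sup>+\<omega>. ennreal_of_enat (return_time X x \<omega>) \<partial>M) < \<infinity>)"

end

theory Submission
  imports Defs
begin

text \<open>
  Alternate two independent renewal processes with steps \<open>\<xi>\<close> and \<open>-\<xi>'\<close>, always moving the one
  that is behind: their difference is the oscillating walk. This suggests the invariant measure
  \<open>\<nu>\<close>, with density \<open>\<mu>]x,\<infinity>[\<close> at \<open>x \<ge> 0\<close> and \<open>\<mu>']-\<infinity>,x]\<close> at \<open>x < 0\<close>, of total mass
  \<open>E \<xi>\<^sub>1 + E (-\<xi>'\<^sub>1)\<close>. Its invariance holds because, for jumps \<open>j < 0 < k\<close>, the intervals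
  \<open>[j, j+k[\<close> and \<open>[j+k, k[\<close> tile \<open>[j, k[\<close>. If the mass is finite, the expected return time is
  finite by Kac's argument.

  In general \<open>\<nu>\<close> may be infinite, but the flux it sends across the origin is
  \<open>2 E min(\<xi>\<^sub>1, -\<xi>'\<^sub>1)\<close> for independent \<open>\<xi>\<^sub>1\<close>, \<open>\<xi>'\<^sub>1\<close>, at most \<open>2 E \<xi>\<^sub>1\<^sup>p E (-\<xi>'\<^sub>1)\<^sup>q\<close>. Let \<open>g x\<close>
  be the probability of never being at \<open>y\<close> from \<open>x\<close> on. Moves that do not cross the origin
  decrease \<open>\<bar>x\<bar>\<close>, so the balance of \<open>g\<close> against \<open>\<nu>\<close> can be drawn on \<open>{-N..N}\<close> and, as
  \<open>N \<rightarrow> \<infinity>\<close>, shows that \<open>\<nu> y\<close> times the probability of no return to \<open>y\<close> is the defect of a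
  finite flux, hence zero.
\<close>

section \<open>Reaching the origin by ordering jumps of both signs\<close>

text \<open>
  A submonoid of the integers that contains elements of both signs is a group, hence the ideal
  generated by its Gcd.
\<close>

lemma int_sum_list_surj:
  fixes A :: "int set"
  assumes "Gcd A = 1" and s: "s \<in> A" "s > 0" and t: "t \<in> A" "t < 0"
  shows "\<exists>l. set l \<subseteq> A \<and> sum_list l = x"
proof -
  define T where "T = {sum_list l | l. set l \<subseteq> A}"
  have zero: "0 \<in> T"
    unfolding T_def by (rule CollectI, rule exI[of _ "[]"]) simp
  have add: "a + b \<in> T" if "a \<in> T" "b \<in> T" for a b
  proof -
    from that obtain k l where "a = sum_list k" "b = sum_list l" "set k \<subseteq> A" "set l \<subseteq> A"
      unfolding T_def by auto
    then show ?thesis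
      unfolding T_def by (intro CollectI exI[of _ "k @ l"]) auto
  qed
  have gen: "a \<in> T" if "a \<in> A" for a
    unfolding T_def using that by (intro CollectI exI[of _ "[a]"]) auto
  have mult: "int n * a \<in> T" if "a \<in> T" for n a
    by (induction n) (auto simp: zero algebra_simps intro: add that)
  have neg_pos: "- a \<in> T" if "a \<in> T" "a > 0" for a
  proof -
    \<comment> \<open>\<open>a\<close> copies of \<open>t\<close> cancel \<open>- t\<close> copies
      of \<open>a\<close>; one copy of \<open>a\<close> fewer leaves \<open>- a\<close>.\<close>
    have "int (nat (- t - 1)) * a + int (nat a) * t \<in> T"
      by (intro add mult that gen t)
    moreover have "int (nat (- t - 1)) * a + int (nat a) * t = - a"
      using t that by (simp add: algebra_simps)
    ultimately show ?thesis by simp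
  qed
  have neg: "- a \<in> T" if "a \<in> T" for a
  proof (cases a "0 :: int" rule: linorder_cases)
    case less
    have "int (nat (s - 1)) * a + int (nat (- a)) * s \<in> T"
      by (intro add mult that gen s)
    moreover have "int (nat (s - 1)) * a + int (nat (- a)) * s = - a"
      using s less by (simp add: algebra_simps)
    ultimately show ?thesis by simp
  qed (use neg_pos that zero in auto)
  have smult: "c * a \<in> T" if "a \<in> T" for c a
    using mult[OF that, of "nat c"] mult[OF neg[OF that], of "nat (- c)"] by (cases "c \<ge> 0") auto
  \<comment> \<open>The least positive element divides all of \<open>A\<close>: remainders modulo
    \<open>d\<close> lie in \<open>T\<close> and are smaller, hence zero.\<close>
  define d where "d = (LEAST n. n > 0 \<and> int n \<in> T)"
  have ex: "nat s > 0 \<and> int (nat s) \<in> T"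
    using s gen by auto
  have d: "d > 0" "int d \<in> T"
    using LeastI[of "\<lambda>n. n > 0 \<and> int n \<in> T", OF ex] unfolding d_def by auto
  have "int d dvd a" if "a \<in> A" for a
  proof -
    have "a + (- (a div int d)) * int d \<in> T"
      by (intro add smult gen that d)
    then have r: "a mod int d \<in> T"
      by (simp add: minus_div_mult_eq_mod)
    have "0 \<le> a mod int d" "a mod int d < int d"
      using d(1) by simp_all
    moreover have "\<not> 0 < nat (a mod int d)" if "nat (a mod int d) < d"
      using not_less_Least[of "nat (a mod int d)" "\<lambda>n. n > 0 \<and> int n \<in> T"] r that
      unfolding d_def[symmetric] by simp
    ultimately have "a mod int d = 0" by (metis nat_less_iff zero_less_nat_eq order_le_less)
    then show ?thesis by auto
  qed
  then have "int d dvd Gcd A" by (rule Gcd_greatest)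
  with \<open>Gcd A = 1\<close> have "d = 1" by simp
  with smult[OF d(2), of x] show ?thesis
    unfolding T_def by auto
qed

text \<open>The step stays a pair, since its components may be dependent, and paths become left
  folds over lists of pairs.\<close>

definition osc_step :: "int \<Rightarrow> int \<times> int \<Rightarrow> int" where
  "osc_step x z = (if x \<le> -1 then x + fst z else x + snd z)"

text \<open>The jumps in \<open>l\<close> can be used up greedily. What remains always sums to minus
  the position, so a negative position leaves some positive jump and a nonnegative one some negative
  jump. Each jump is completed to a pair of \<open>S\<close> whose other component the move
  ignores.\<close>

lemma osc_step_reaches_0:
  assumes "x + sum_list l = 0" "set l \<subseteq> fst ` S \<union> snd ` S"
    and "\<And>z. z \<in> S \<Longrightarrow> fst z > 0" "\<And>z. z \<in> S \<Longrightarrow> snd z < 0"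
  shows "\<exists>zs. set zs \<subseteq> S \<and> foldl osc_step x zs = 0"
  using assms(1,2)
proof (induction "length l" arbitrary: x l)
  case 0
  then show ?case by (intro exI[of _ "[]"]) auto
next
  case (Suc n)
  have rem: "sum_list (remove1 a l) = sum_list l - a" "length (remove1 a l) = n"
      "set (remove1 a l) \<subseteq> fst ` S \<union> snd ` S" if "a \<in> set l" for a
    using that Suc.hyps(2) Suc.prems(2) sum_list_map_remove1[OF that, of "\<lambda>a. a"] set_remove1_subset[of a l]
    by (auto simp: length_remove1)
  have go: ?case if "z \<in> S" "a \<in> set l" "osc_step x z = x + a" for z a
  proof -
    have "\<exists>zs. set zs \<subseteq> S \<and> foldl osc_step (x + a) zs = 0"
      by (rule Suc.hyps(1)[of "remove1 a l"]) (use rem[OF that(2)] Suc.prems in auto)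
    then obtain zs where "set zs \<subseteq> S" "foldl osc_step (x + a) zs = 0" by auto
    then show ?thesis
      using that by (intro exI[of _ "z # zs"]) auto
  qed
  have sgn: "(\<exists>z\<in>S. a = fst z \<and> a > 0) \<or> (\<exists>z\<in>S. a = snd z \<and> a < 0)" if "a \<in> set l" for a
  proof -
    from that Suc.prems(2) have "a \<in> fst ` S \<union> snd ` S" by (rule subsetD[rotated])
    then obtain z where "z \<in> S" "a = fst z \<or> a = snd z" by auto
    then show ?thesis using assms(3)[of z] assms(4)[of z] by auto
  qed
  show ?case
  proof (cases "x \<le> -1")
    case True
    have "\<exists>a\<in>set l. a > 0"
      using sum_list_nonpos[of l] Suc.prems(1) True by force
    then obtain a where a: "a \<in> set l" "a > 0" by auto
    then obtain z where "z \<in> S" "a = fst z"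
      using sgn[OF a(1)] by auto
    then show ?thesis using a go True by (auto simp: osc_step_def)
  next
    case False
    have "\<exists>a\<in>set l. a < 0"
    proof (rule ccontr)
      assume "\<not> ?thesis"
      then have l: "0 < a" if "a \<in> set l" for a
        using sgn[OF that] that by auto
      then have "sum_list l \<ge> 0" by (intro sum_list_nonneg) (simp add: less_imp_le)
      \<comment> \<open>At \<open>x = 0\<close> the remaining sum is zero, so nonnegativity alone
        gives no contradiction; but \<open>l\<close> is nonempty with positive entries.\<close>
      moreover have "sum_list l \<noteq> 0"
      proof (cases l)
        case (Cons a k)
        then have "a > 0" "sum_list k \<ge> 0"
          using l by (simp_all add: sum_list_nonneg less_imp_le)
        then show ?thesis using Cons by simp
      qed (use Suc.hyps(2) in simp)
      ultimately show False using False Suc.prems(1) by auto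
    qed
    then obtain a where a: "a \<in> set l" "a < 0" by auto
    then obtain z where "z \<in> S" "a = snd z"
      using sgn[OF a(1)] by auto
    then show ?thesis using a go False by (auto simp: osc_step_def)
  qed
qed

section \<open>Avoidance probabilities of a Markov kernel\<close>

text \<open>Only the marginals enter, since a move reads a single component of the step
  pair.\<close>

definition osc_kernel :: "int pmf \<Rightarrow> int pmf \<Rightarrow> int \<Rightarrow> int pmf" where
  "osc_kernel \<mu> \<mu>' x = map_pmf ((+) x) (if x \<le> -1 then \<mu> else \<mu>')"

text \<open>The probability of avoiding \<open>y\<close> at the times \<open>1..n\<close> from
  \<open>x\<close>. Time zero is not tested, so at \<open>x = y\<close> this is the tail of the
  return time.\<close>

primrec avoid :: "('s \<Rightarrow> 's pmf) \<Rightarrow> 's \<Rightarrow> nat \<Rightarrow> 's \<Rightarrow> ennreal" where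
  "avoid K y 0 x = 1"
| "avoid K y (Suc n) x = (\<integral>\<^sup>+z. (if z = y then 0 else avoid K y n z) \<partial>K x)"

lemma avoid_le_1: "avoid K y n x \<le> 1"
proof (induction n arbitrary: x)
  case (Suc n)
  have "avoid K y (Suc n) x \<le> (\<integral>\<^sup>+z. 1 \<partial>K x)"
    unfolding avoid.simps by (intro nn_integral_mono) (use Suc in auto)
  then show ?case by simp
qed simp

lemma avoid_Suc_le: "avoid K y (Suc n) x \<le> avoid K y n x"
proof (induction n arbitrary: x)
  case 0
  then show ?case using avoid_le_1[of K y 1 x] by simp
next
  case (Suc n)
  show ?case
    unfolding avoid.simps(2)[of K y "Suc n"] avoid.simps(2)[of K y n]
    by (intro nn_integral_mono) (use Suc in auto)
qed

text \<open>First-step analysis passes to the limit by decreasing monotone convergence, the bound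
  one giving integrability. So the limit, set to zero at \<open>y\<close>, is harmonic away from
  \<open>y\<close>.\<close>

lemma avoid_INF_eq:
  "(INF n. avoid K y n x) = (\<integral>\<^sup>+z. (if z = y then 0 else INF n. avoid K y n z) \<partial>K x)"
proof -
  have dec: "decseq (\<lambda>n. avoid K y n x)" for x
    by (intro decseq_SucI avoid_Suc_le)
  have "(INF n. avoid K y n x) = (INF n. avoid K y (Suc n) x)"
  proof (rule antisym)
    show "(INF n. avoid K y n x) \<le> (INF n. avoid K y (Suc n) x)"
      by (rule INF_greatest, rule INF_lower) simp
    show "(INF n. avoid K y (Suc n) x) \<le> (INF n. avoid K y n x)"
      by (rule INF_mono) (metis UNIV_I avoid_Suc_le)
  qed
  also have "\<dots> = (\<integral>\<^sup>+z. (INF n. (if z = y then 0 else avoid K y n z)) \<partial>K x)"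
    unfolding avoid.simps
  proof (rule nn_integral_monotone_convergence_INF_decseq[symmetric])
    show "decseq (\<lambda>n z. if z = y then 0 else avoid K y n z)"
      using avoid_Suc_le by (intro decseq_SucI) (auto simp: le_fun_def)
    have "(\<integral>\<^sup>+z. (if z = y then 0 else avoid K y 0 z) \<partial>K x) \<le> (\<integral>\<^sup>+z. 1 \<partial>K x)"
      by (intro nn_integral_mono) auto
    then show "(\<integral>\<^sup>+z. (if z = y then 0 else avoid K y 0 z) \<partial>K x) < \<infinity>"
      by (simp add: le_less_trans)
  qed simp
  also have "\<dots> = (\<integral>\<^sup>+z. (if z = y then 0 else INF n. avoid K y n z) \<partial>K x)"
    by (intro nn_integral_cong) auto
  finally show ?thesis .
qed

section \<open>The invariant measure\<close>

text \<open>Zero counts as a point of the right half-line, as in the rule for the moves.\<close>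

definition crossing :: "int \<Rightarrow> int \<Rightarrow> bool" where
  "crossing x z \<longleftrightarrow> (x < 0) \<noteq> (z < 0)"

locale opposite_jumps =
  fixes \<mu> \<mu>' :: "int pmf"
  assumes pos: "k \<in> set_pmf \<mu> \<Longrightarrow> k > 0"
    and neg: "k \<in> set_pmf \<mu>' \<Longrightarrow> k < 0"
begin

abbreviation K where "K \<equiv> osc_kernel \<mu> \<mu>'"

text \<open>The integral of \<open>f\<close> against the invariant measure.\<close>

definition flow :: "(int \<Rightarrow> ennreal) \<Rightarrow> ennreal" where
  "flow f = (\<integral>\<^sup>+k. (\<Sum>x\<in>{0..<k}. f x) \<partial>\<mu>) + (\<integral>\<^sup>+j. (\<Sum>x\<in>{j..<0}. f x) \<partial>\<mu>')"

lemma flow_mono: "(\<And>x. f x \<le> g x) \<Longrightarrow> flow f \<le> flow g"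
  unfolding flow_def by (intro add_mono nn_integral_mono sum_mono)

lemma flow_add: "flow (\<lambda>x. f x + g x) = flow f + flow g"
  unfolding flow_def by (simp add: sum.distrib nn_integral_add algebra_simps)

lemma flow_cmult: "flow (\<lambda>x. c * f x) = c * flow f"
  unfolding flow_def by (simp add: sum_distrib_left[symmetric] nn_integral_cmult distrib_left)

lemma flow_LIMSEQ:
  assumes "incseq f" "\<And>x. (\<lambda>n. f n x) \<longlonglongrightarrow> g x"
  shows "(\<lambda>n. flow (f n)) \<longlonglongrightarrow> flow g"
  unfolding flow_def
  by (intro tendsto_add nn_integral_LIMSEQ tendsto_sum assms(2))
     (use assms(1) in \<open>auto simp: incseq_def le_fun_def intro!: sum_mono\<close>)

text \<open>The density is itself an integral over a jump, so a weighted move involves two jumps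
  drawn independently from the marginals: at \<open>x \<ge> 0\<close>, \<open>k\<close> gives the
  weight and \<open>j\<close> the move, and at \<open>x < 0\<close> the roles are exchanged.\<close>

lemma flow_edges:
  "flow (\<lambda>x. \<integral>\<^sup>+z. F x z \<partial>K x) =
     (\<integral>\<^sup>+k. \<integral>\<^sup>+j. (\<Sum>x\<in>{0..<k}. F x (x + j)) + (\<Sum>x\<in>{j..<0}. F x (x + k)) \<partial>\<mu>' \<partial>\<mu>)"
proof -
  have "(\<integral>\<^sup>+k. (\<Sum>x\<in>{0..<k}. \<integral>\<^sup>+z. F x z \<partial>K x) \<partial>\<mu>) =
      (\<integral>\<^sup>+k. \<integral>\<^sup>+j. (\<Sum>x\<in>{0..<k}. F x (x + j)) \<partial>\<mu>' \<partial>\<mu>)"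
    by (simp add: osc_kernel_def nn_integral_sum)
  moreover have "(\<integral>\<^sup>+j. (\<Sum>x\<in>{j..<0}. \<integral>\<^sup>+z. F x z \<partial>K x) \<partial>\<mu>') =
      (\<integral>\<^sup>+j. \<integral>\<^sup>+k. (\<Sum>x\<in>{j..<0}. F x (x + k)) \<partial>\<mu> \<partial>\<mu>')"
    by (simp add: osc_kernel_def nn_integral_sum)
  \<comment> \<open>Tonelli, obtained by commuting the factors of a product pmf.\<close>
  moreover have "\<dots> = (\<integral>\<^sup>+k. \<integral>\<^sup>+j. (\<Sum>x\<in>{j..<0}. F x (x + k)) \<partial>\<mu>' \<partial>\<mu>)"
    using arg_cong[OF pair_commute_pmf[of \<mu>' \<mu>],
      of "\<lambda>p. \<integral>\<^sup>+z. (case z of (j, k) \<Rightarrow> \<Sum>x\<in>{j..<0}. F x (x + k)) \<partial>p"]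
    by (simp add: nn_integral_pair_pmf' case_prod_unfold)
  ultimately show ?thesis
    by (simp add: flow_def nn_integral_add)
qed

text \<open>Invariance holds before integrating: for each pair of jumps, the translated blocks and
  the original ones both tile \<open>{j..<k}\<close>.\<close>

lemma flow_kernel: "flow (\<lambda>x. \<integral>\<^sup>+z. f z \<partial>K x) = flow f"
proof -
  have *: "(\<Sum>x\<in>{0..<k}. f (x + j)) + (\<Sum>x\<in>{j..<0}. f (x + k)) =
      (\<Sum>x\<in>{0..<k}. f x) + (\<Sum>x\<in>{j..<0}. f x)" if "k > 0" "j < 0" for k j
  proof -
    have "(\<Sum>x\<in>{0..<k}. f (x + j)) = (\<Sum>x\<in>{j..<j + k}. f x)"
      by (rule sum.reindex_bij_witness[of _ "\<lambda>x. x - j" "\<lambda>x. x + j"]) auto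
    moreover have "(\<Sum>x\<in>{j..<0}. f (x + k)) = (\<Sum>x\<in>{j + k..<k}. f x)"
      by (rule sum.reindex_bij_witness[of _ "\<lambda>x. x - k" "\<lambda>x. x + k"]) auto
    moreover have "(\<Sum>x\<in>{j..<j + k}. f x) + (\<Sum>x\<in>{j + k..<k}. f x) = (\<Sum>x\<in>{j..<k}. f x)"
      using that by (subst sum.union_disjoint[symmetric]) (auto intro!: sum.cong)
    moreover have "(\<Sum>x\<in>{j..<0}. f x) + (\<Sum>x\<in>{0..<k}. f x) = (\<Sum>x\<in>{j..<k}. f x)"
      using that by (subst sum.union_disjoint[symmetric]) (auto intro!: sum.cong)
    ultimately show ?thesis by (simp add: add.commute)
  qed
  have "flow (\<lambda>x. \<integral>\<^sup>+z. f z \<partial>K x) =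
      (\<integral>\<^sup>+k. \<integral>\<^sup>+j. (\<Sum>x\<in>{0..<k}. f x) + (\<Sum>x\<in>{j..<0}. f x) \<partial>\<mu>' \<partial>\<mu>)"
    unfolding flow_edges
    by (intro nn_integral_cong_AE AE_pmfI) (simp add: * pos neg)
  then show ?thesis by (simp add: flow_def nn_integral_add)
qed

section \<open>Recurrence from a finite flux across the origin\<close>

text \<open>The subscripts in \<open>K\<^sub>s\<close> and \<open>K\<^sub>c\<close> stand for same
  side and crossing. The split separates the moves that cannot leave a window
  \<open>{- N..N}\<close> from those that can.\<close>

definition K\<^sub>s :: "(int \<Rightarrow> ennreal) \<Rightarrow> int \<Rightarrow> ennreal" where
  "K\<^sub>s f x = (\<integral>\<^sup>+z. (if crossing x z then 0 else f z) \<partial>K x)"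

definition K\<^sub>c :: "(int \<Rightarrow> ennreal) \<Rightarrow> int \<Rightarrow> ennreal" where
  "K\<^sub>c f x = (\<integral>\<^sup>+z. (if crossing x z then f z else 0) \<partial>K x)"

lemma kernel_split: "(\<integral>\<^sup>+z. f z \<partial>K x) = K\<^sub>s f x + K\<^sub>c f x"
  unfolding K\<^sub>s_def K\<^sub>c_def
  by (subst nn_integral_add[symmetric]) (auto intro!: nn_integral_cong)

text \<open>The density is at most one, so a window has finite mass even if the total mass is
  infinite. This is what allows the cancellation in \<open>avoidance_zero\<close>.\<close>

lemma flow_cutoff_finite: "flow (indicator {- int N..int N}) < \<infinity>"
proof -
  have b: "(\<Sum>x\<in>{a..<b}. indicator {- int N..int N} x) \<le> (of_nat (card {- int N..int N}) :: ennreal)" for a b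
  proof -
    have "(\<Sum>x\<in>{a..<b}. indicator {- int N..int N} x) = (of_nat (card ({a..<b} \<inter> {- int N..int N})) :: ennreal)"
      by (simp add: indicator_def sum.If_cases Int_def)
    also have "\<dots> \<le> of_nat (card {- int N..int N})"
      by (intro of_nat_mono card_mono finite_atLeastAtMost_int Int_lower2)
    finally show ?thesis .
  qed
  have "(\<integral>\<^sup>+k. (\<Sum>x\<in>{0..<k}. indicator {- int N..int N} x) \<partial>\<mu>) \<le> (\<integral>\<^sup>+k. of_nat (card {- int N..int N}) \<partial>\<mu>)"
    by (intro nn_integral_mono b)
  moreover have "(\<integral>\<^sup>+k. (\<Sum>x\<in>{k..<0}. indicator {- int N..int N} x) \<partial>\<mu>') \<le> (\<integral>\<^sup>+k. of_nat (card {- int N..int N}) \<partial>\<mu>')"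
    by (intro nn_integral_mono b)
  ultimately have "flow (indicator {- int N..int N}) \<le> of_nat (card {- int N..int N}) + of_nat (card {- int N..int N})"
    unfolding flow_def by (intro add_mono) auto
  also have "\<dots> < \<infinity>"
    by (simp add: of_nat_less_top flip: of_nat_add)
  finally show ?thesis .
qed

text \<open>Cut \<open>g\<close> off outside \<open>{- N..N}\<close> and estimate its flow in two
  ways, by invariance and by harmonicity away from \<open>y\<close>. The same-side terms are finite
  and cancel, leaving the crossing flux of the cut-off \<open>g\<close> plus the defect at
  \<open>y\<close>, bounded by the crossing flux of \<open>g\<close>. As \<open>N\<close> grows the
  first flux tends to the second, which is finite, so the defect vanishes.\<close>

lemma avoidance_zero:
  assumes fin: "flow (K\<^sub>c (\<lambda>_. 1)) < \<infinity>"
    and y: "flow (indicator {y}) > 0"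
    and g1: "\<And>x. g x \<le> 1" and gy: "g y = 0"
    and g: "\<And>x. x \<noteq> y \<Longrightarrow> g x = (\<integral>\<^sup>+z. g z \<partial>K x)"
  shows "(\<integral>\<^sup>+z. g z \<partial>K y) = 0"
proof -
  define I :: "nat \<Rightarrow> int \<Rightarrow> ennreal" where "I N = indicator {- int N..int N}" for N
  define G where "G N x = I N x * g x" for N x
  define r where "r = (\<integral>\<^sup>+z. g z \<partial>K y)"
  have fin_g: "flow (K\<^sub>c g) < \<infinity>"
    using fin by (rule le_less_trans[rotated]) (auto intro!: flow_mono nn_integral_mono simp: K\<^sub>c_def g1)
  have step: "flow (K\<^sub>c (G N)) + r * flow (indicator {y}) \<le> flow (K\<^sub>c g)" if N: "nat \<bar>y\<bar> \<le> N" for N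
  proof -
    let ?a = "flow (\<lambda>x. I N x * K\<^sub>s g x)"
    have "flow (G N) = flow (\<lambda>x. K\<^sub>s (G N) x + K\<^sub>c (G N) x)"
      by (subst flow_kernel[symmetric]) (simp add: kernel_split)
    also have "\<dots> \<ge> ?a + flow (K\<^sub>c (G N))"
      unfolding flow_add
    proof (intro add_mono flow_mono order.refl)
      fix x
      have "I N x * K\<^sub>s g x = (\<integral>\<^sup>+z. I N x * (if crossing x z then 0 else g z) \<partial>K x)"
        by (simp add: K\<^sub>s_def nn_integral_cmult)
      also have "\<dots> \<le> K\<^sub>s (G N) x"
        unfolding K\<^sub>s_def
      proof (intro nn_integral_mono_AE AE_pmfI)
        fix z assume "z \<in> set_pmf (K x)"
        \<comment> \<open>Moves go towards the origin, so one that does not cross it cannot leave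
          the window.\<close>
        then have "(x \<le> -1 \<and> z > x) \<or> (x \<ge> 0 \<and> z < x)"
          using pos neg by (auto simp: osc_kernel_def split: if_splits)
        then show "I N x * (if crossing x z then 0 else g z) \<le> (if crossing x z then 0 else G N z)"
          by (auto simp: G_def I_def crossing_def split: split_indicator)
      qed
      finally show "I N x * K\<^sub>s g x \<le> K\<^sub>s (G N) x" .
    qed
    finally have 1: "?a + flow (K\<^sub>c (G N)) \<le> flow (G N)" .
    \<comment> \<open>Harmonicity can fail only at \<open>y\<close>, where \<open>g\<close> is zero
      and its average is \<open>r\<close>; the extra term repairs this, as \<open>y\<close> lies in
      the window.\<close>
    have "G N x + r * indicator {y} x = I N x * K\<^sub>s g x + I N x * K\<^sub>c g x" for x
    proof (cases "x = y")
      case True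
      then have "I N x = 1" using N by (simp add: I_def indicator_def) linarith
      then show ?thesis using True by (simp add: G_def gy r_def kernel_split)
    next
      case False
      then show ?thesis
        using g[OF False] by (simp add: G_def kernel_split distrib_left)
    qed
    then have "flow (G N) + r * flow (indicator {y}) = ?a + flow (\<lambda>x. I N x * K\<^sub>c g x)"
      by (simp flip: flow_add flow_cmult)
    also have "\<dots> \<le> ?a + flow (K\<^sub>c g)"
      by (intro add_left_mono flow_mono) (auto simp: I_def split: split_indicator)
    finally have "flow (G N) + r * flow (indicator {y}) \<le> ?a + flow (K\<^sub>c g)" .
    then have "?a + (flow (K\<^sub>c (G N)) + r * flow (indicator {y})) \<le> ?a + flow (K\<^sub>c g)"
      using order_trans[OF add_right_mono[OF 1]] by (simp only: add.assoc)
    \<comment> \<open>Cancelling \<open>?a\<close> in \<open>ennreal\<close> requires this; by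
      \<open>1\<close> it is at most the mass of the window.\<close>
    moreover have "?a \<noteq> \<top>"
    proof -
      have "flow (G N) \<le> flow (I N)"
        by (intro flow_mono) (use g1 in \<open>auto simp: G_def I_def split: split_indicator\<close>)
      with 1 have "?a + flow (K\<^sub>c (G N)) \<le> flow (I N)"
        by (rule order_trans)
      moreover have "?a + 0 \<le> ?a + flow (K\<^sub>c (G N))"
        by (intro add_left_mono) simp
      ultimately have "?a + 0 \<le> flow (I N)" by (rule order_trans[rotated])
      then have "?a \<le> flow (I N)" by simp
      also have "\<dots> < \<infinity>"
        unfolding I_def by (rule flow_cutoff_finite)
      finally show ?thesis by simp
    qed
    ultimately show ?thesis
      by (simp add: ennreal_add_left_cancel_le)
  qed
  have "(\<lambda>N. flow (K\<^sub>c (G N))) \<longlonglongrightarrow> flow (K\<^sub>c g)"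
  proof (intro flow_LIMSEQ)
    have mono: "G M x \<le> G N x" if "M \<le> N" for M N x
      using that by (auto simp: G_def I_def split: split_indicator)
    then show "incseq (\<lambda>N. K\<^sub>c (G N))"
      by (auto simp: incseq_def le_fun_def K\<^sub>c_def intro!: nn_integral_mono)
    fix x
    show "(\<lambda>N. K\<^sub>c (G N) x) \<longlonglongrightarrow> K\<^sub>c g x"
      unfolding K\<^sub>c_def
    proof (rule nn_integral_LIMSEQ)
      show "incseq (\<lambda>N z. if crossing x z then G N z else 0)"
        using mono by (auto simp: incseq_def le_fun_def)
      fix z
      have "eventually (\<lambda>N. G N z = g z) sequentially"
        using eventually_ge_at_top[of "nat \<bar>z\<bar>"]
        by eventually_elim (auto simp: G_def I_def indicator_def)
      then show "(\<lambda>N. if crossing x z then G N z else 0) \<longlonglongrightarrow> (if crossing x z then g z else 0)"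
        by (auto intro: tendsto_eventually)
    qed simp
  qed
  then have "(\<lambda>N. flow (K\<^sub>c (G N)) + r * flow (indicator {y})) \<longlonglongrightarrow> flow (K\<^sub>c g) + r * flow (indicator {y})"
    by (intro tendsto_intros)
  then have "flow (K\<^sub>c g) + r * flow (indicator {y}) \<le> flow (K\<^sub>c g) + 0"
    by (rule LIMSEQ_le_const2) (use step in auto)
  then have "r * flow (indicator {y}) = 0"
    using fin_g by (auto simp add: ennreal_add_left_cancel_le simp del: add_0_right)
  then show ?thesis using y by (auto simp: r_def)
qed

text \<open>The test function is the probability of never being at \<open>y\<close>, time zero
  included: it is zero at \<open>y\<close> and harmonic elsewhere by
  \<open>avoid_INF_eq\<close>.\<close>

lemma avoid_tends_0:
  assumes "flow (K\<^sub>c (\<lambda>_. 1)) < \<infinity>" "flow (indicator {y}) > 0"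
  shows "(INF n. avoid K y n y) = 0"
proof -
  have "(\<integral>\<^sup>+z. (if z = y then 0 else INF n. avoid K y n z) \<partial>K y) = 0"
  proof (rule avoidance_zero[OF assms])
    have "(INF n. avoid K y n x) \<le> 1" for x
      by (rule INF_lower2[of 0]) auto
    then show "(if x = y then 0 else INF n. avoid K y n x) \<le> 1" for x
      by simp
  qed (simp_all add: avoid_INF_eq[symmetric])
  then show ?thesis by (subst avoid_INF_eq)
qed

section \<open>Kac's argument for a finite invariant measure\<close>

text \<open>\<open>flow (g n)\<close> is the mass of the paths, started from the invariant measure,
  that are not at \<open>y\<close> at the times \<open>0..n\<close>. By invariance, passing to
  \<open>Suc n\<close> loses \<open>avoid K y (Suc n) y\<close> times the mass of \<open>y\<close>,
  and the losses add up to at most the total mass. The sum is the expected return time.\<close>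

lemma avoid_sum_finite:
  assumes fin: "flow (\<lambda>_. 1) < \<infinity>" and y: "flow (indicator {y}) > 0"
  shows "(\<Sum>n. avoid K y n y) < \<infinity>"
proof -
  define g where "g n x = (if x = y then 0 else avoid K y n x)" for n x
  let ?m = "flow (indicator {y})"
  have eq: "flow (g n) = flow (g (Suc n)) + avoid K y (Suc n) y * ?m" for n
  proof -
    have "flow (g n) = flow (avoid K y (Suc n))"
    proof -
      have "avoid K y (Suc n) = (\<lambda>x. \<integral>\<^sup>+z. g n z \<partial>K x)"
        by (simp add: fun_eq_iff g_def)
      then show ?thesis by (simp only: flow_kernel)
    qed
    also have "avoid K y (Suc n) = (\<lambda>x. g (Suc n) x + avoid K y (Suc n) y * indicator {y} x)"
      by (auto simp: fun_eq_iff g_def simp del: avoid.simps)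
    finally show ?thesis by (simp add: flow_add flow_cmult del: avoid.simps)
  qed
  have total: "flow (g 0) = flow (g N) + (\<Sum>n<N. avoid K y (Suc n) y) * ?m" for N
  proof (induction N)
    case (Suc N)
    have "flow (g 0) = flow (g (Suc N)) + avoid K y (Suc N) y * ?m + (\<Sum>n<N. avoid K y (Suc n) y) * ?m"
      using Suc eq[of N] by simp
    then show ?case by (simp add: algebra_simps del: avoid.simps)
  qed simp
  have "(\<Sum>n<N. avoid K y (Suc n) y) * ?m \<le> flow (g 0)" for N
    by (subst total[of N]) (simp add: add_increasing del: avoid.simps)
  moreover have "flow (g 0) \<le> flow (\<lambda>_. 1)"
    by (intro flow_mono) (auto simp: g_def)
  ultimately have le: "(\<Sum>n<N. avoid K y (Suc n) y) * ?m \<le> flow (\<lambda>_. 1)" for N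
    by (meson order_trans)
  have "(\<Sum>n. avoid K y (Suc n) y) * ?m \<le> flow (\<lambda>_. 1)"
    unfolding ennreal_suminf_multc[symmetric]
    by (intro suminf_le_const) (use le in \<open>auto simp: sum_distrib_right\<close>)
  then have "(\<Sum>n. avoid K y (Suc n) y) < \<infinity>"
    using fin y by (metis ennreal_mult_eq_top_iff infinity_ennreal_def leD less_top neq_iff order_le_less_trans)
  \<comment> \<open>The telescoped sum starts at index one; the term of index zero is one.\<close>
  then have "(\<Sum>n. avoid K y (Suc n) y) + avoid K y 0 y < \<infinity>"
    by simp
  then show ?thesis
    using suminf_offset[of "\<lambda>n. avoid K y n y" 1] by (simp add: add.commute del: avoid.simps(2))
qed

section \<open>Support, mass and crossing flux of the invariant measure\<close>

lemma flow_pos: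
  assumes "(y \<ge> 0 \<and> (\<exists>k\<in>set_pmf \<mu>. y < k)) \<or> (y < 0 \<and> (\<exists>j\<in>set_pmf \<mu>'. j \<le> y))"
  shows "flow (indicator {y}) > 0"
proof -
  have *: "(\<integral>\<^sup>+k. (\<Sum>x\<in>A k. indicator {y} x) \<partial>p) > 0" if "k \<in> set_pmf p" "y \<in> A k" "\<And>k. finite (A k)"
    for p :: "int pmf" and A and k
  proof (rule ccontr)
    assume "\<not> ?thesis"
    then have "AE k in p. (\<Sum>x\<in>A k. indicator {y} x :: ennreal) = 0"
      by (subst nn_integral_0_iff_AE[symmetric]) auto
    then have "(\<Sum>x\<in>A k. indicator {y} x :: ennreal) = 0"
      using that(1) by (simp add: AE_measure_pmf_iff)
    then show False using that by (auto simp: sum_eq_0_iff)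
  qed
  from assms show ?thesis
  proof
    assume "y \<ge> 0 \<and> (\<exists>k\<in>set_pmf \<mu>. y < k)"
    then obtain k where "k \<in> set_pmf \<mu>" "y \<in> {0..<k}" by auto
    then show ?thesis
      unfolding flow_def by (intro add_pos_nonneg *[where A = "\<lambda>k. {0..<k}"]) auto
  next
    assume "y < 0 \<and> (\<exists>j\<in>set_pmf \<mu>'. j \<le> y)"
    then obtain k where "k \<in> set_pmf \<mu>'" "y \<in> {k..<0}" by auto
    then show ?thesis
      unfolding flow_def by (intro add_nonneg_pos *[where A = "\<lambda>k. {k..<0}"]) auto
  qed
qed

lemma flow_1: "flow (\<lambda>_. 1) = (\<integral>\<^sup>+k. of_nat (nat k) \<partial>\<mu>) + (\<integral>\<^sup>+j. of_nat (nat (- j)) \<partial>\<mu>')"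
  by (simp add: flow_def)

text \<open>A jump \<open>j\<close> carries the \<open>min k (- j)\<close> lowest points of
  \<open>{0..<k}\<close> below zero, and a jump \<open>k\<close> carries equally many points of
  \<open>{j..<0}\<close> across the origin in the other direction.\<close>

lemma flow_crossing_le:
  "flow (K\<^sub>c (\<lambda>_. 1)) \<le> 2 * (\<integral>\<^sup>+k. \<integral>\<^sup>+j. of_nat (nat (min k (- j))) \<partial>\<mu>' \<partial>\<mu>)"
proof -
  have *: "(\<Sum>x\<in>{0..<k}. if crossing x (x + j) then 1 else 0) + (\<Sum>x\<in>{j..<0}. if crossing x (x + k) then 1 else 0)
      \<le> (2 * of_nat (nat (min k (- j))) :: ennreal)" if "k > 0" "j < 0" for k j
  proof -
    have "(\<Sum>x\<in>{0..<k}. if crossing x (x + j) then 1 else 0) = (\<Sum>x\<in>{0..<min k (- j)}. (1::ennreal))"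
      using that by (intro sum.mono_neutral_cong_right) (auto simp: crossing_def)
    moreover have "(\<Sum>x\<in>{j..<0}. if crossing x (x + k) then 1 else 0) = (\<Sum>x\<in>{max j (- k)..<0}. (1::ennreal))"
      using that by (intro sum.mono_neutral_cong_right) (auto simp: crossing_def)
    moreover have "nat (- max j (- k)) = nat (min k (- j))" by auto
    ultimately show ?thesis by (simp add: mult_2)
  qed
  have "flow (K\<^sub>c (\<lambda>_. 1)) = (\<integral>\<^sup>+k. \<integral>\<^sup>+j. (\<Sum>x\<in>{0..<k}. if crossing x (x + j) then 1 else 0)
      + (\<Sum>x\<in>{j..<0}. if crossing x (x + k) then 1 else 0) \<partial>\<mu>' \<partial>\<mu>)"
    unfolding K\<^sub>c_def flow_edges ..
  also have "\<dots> \<le> (\<integral>\<^sup>+k. \<integral>\<^sup>+j. 2 * of_nat (nat (min k (- j))) \<partial>\<mu>' \<partial>\<mu>)"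
    by (intro nn_integral_mono_AE AE_pmfI * pos neg)
  finally show ?thesis by (simp add: nn_integral_cmult)
qed

text \<open>With \<open>p + q = 1\<close>, the minimum of two positive numbers is at most the power
  \<open>p\<close> of one times the power \<open>q\<close> of the other, and the double integral of
  this product factors into the two moments.\<close>

lemma min_finite:
  fixes p q :: real
  assumes pq: "0 \<le> p" "0 \<le> q" "p + q = 1"
    and "(\<integral>\<^sup>+k. ennreal (real_of_int k powr p) \<partial>\<mu>) < \<infinity>" "(\<integral>\<^sup>+j. ennreal (real_of_int (- j) powr q) \<partial>\<mu>') < \<infinity>"
  shows "(\<integral>\<^sup>+k. \<integral>\<^sup>+j. of_nat (nat (min k (- j))) \<partial>\<mu>' \<partial>\<mu>) < \<infinity>"
proof -
  have "(\<integral>\<^sup>+k. \<integral>\<^sup>+j. of_nat (nat (min k (- j))) \<partial>\<mu>' \<partial>\<mu>) \<le>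
      (\<integral>\<^sup>+k. \<integral>\<^sup>+j. ennreal (real_of_int k powr p) * ennreal (real_of_int (- j) powr q) \<partial>\<mu>' \<partial>\<mu>)"
  proof (intro nn_integral_mono_AE AE_pmfI)
    fix k j assume "k \<in> set_pmf \<mu>" "j \<in> set_pmf \<mu>'"
    then have kj: "k > 0" "j < 0" using pos neg by auto
    define m where "m = real_of_int (min k (- j))"
    have m: "0 < m" "m \<le> real_of_int k" "m \<le> real_of_int (- j)"
      unfolding m_def using kj by (auto simp: min_def)
    have "m = m powr p * m powr q"
      using m pq by (simp flip: powr_add)
    also have "\<dots> \<le> real_of_int k powr p * real_of_int (- j) powr q"
      using m pq by (intro mult_mono powr_mono2) auto
    finally have "ennreal m \<le> ennreal (real_of_int k powr p) * ennreal (real_of_int (- j) powr q)"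
      by (simp add: ennreal_mult'[symmetric] ennreal_leI)
    moreover have "of_nat (nat (min k (- j))) = ennreal m"
      using kj by (simp add: ennreal_of_nat_eq_real_of_nat m_def)
    ultimately show "of_nat (nat (min k (- j))) \<le> ennreal (real_of_int k powr p) * ennreal (real_of_int (- j) powr q)"
      by simp
  qed
  also have "\<dots> = (\<integral>\<^sup>+k. ennreal (real_of_int k powr p) \<partial>\<mu>) * (\<integral>\<^sup>+j. ennreal (real_of_int (- j) powr q) \<partial>\<mu>')"
    by (simp add: nn_integral_cmult nn_integral_multc)
  also have "\<dots> < \<infinity>"
    using assms(4,5) by (simp add: ennreal_mult_less_top)
  finally show ?thesis .
qed

text \<open>By Tonelli the series is the mean, for independent jumps, of the number of
  \<open>n\<close> with \<open>n < k\<close> and \<open>n < - j\<close>, and that number is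
  \<open>nat (min k (- j))\<close>.\<close>

lemma tails_summable:
  assumes "(\<integral>\<^sup>+k. \<integral>\<^sup>+j. of_nat (nat (min k (- j))) \<partial>\<mu>' \<partial>\<mu>) < \<infinity>"
  shows "summable (\<lambda>n::nat. measure_pmf.prob \<mu> {int n<..} * measure_pmf.prob \<mu>' {..<- int n})"
proof (rule summable_suminf_not_top)
  have "(\<Sum>n. ennreal (measure_pmf.prob \<mu> {int n<..} * measure_pmf.prob \<mu>' {..<- int n}))
     = (\<Sum>n. (\<integral>\<^sup>+k. \<integral>\<^sup>+j. indicator {int n<..} k * indicator {..<- int n} j \<partial>\<mu>' \<partial>\<mu>))"
    by (simp add: nn_integral_cmult nn_integral_multc ennreal_mult measure_pmf.emeasure_eq_measure)
  also have "\<dots> = (\<integral>\<^sup>+k. \<integral>\<^sup>+j. (\<Sum>n. indicator {int n<..} k * indicator {..<- int n} j) \<partial>\<mu>' \<partial>\<mu>)"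
    by (simp add: nn_integral_suminf)
  also have "\<dots> = (\<integral>\<^sup>+k. \<integral>\<^sup>+j. of_nat (nat (min k (- j))) \<partial>\<mu>' \<partial>\<mu>)"
  proof (intro nn_integral_cong)
    fix k j
    have "(\<Sum>n. indicator {int n<..} k * indicator {..<- int n} j) =
       (\<Sum>n\<in>{..<nat (min k (- j))}. indicator {int n<..} k * indicator {..<- int n} j :: ennreal)"
      by (rule suminf_finite) (auto split: split_indicator)
    also have "\<dots> = (\<Sum>n\<in>{..<nat (min k (- j))}. 1)"
      by (intro sum.cong) (auto split: split_indicator)
    finally show "(\<Sum>n. indicator {int n<..} k * indicator {..<- int n} j) = (of_nat (nat (min k (- j))) :: ennreal)"
      by simp
  qed
  finally show "(\<Sum>n. ennreal (measure_pmf.prob \<mu> {int n<..} * measure_pmf.prob \<mu>' {..<- int n})) \<noteq> \<top>"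
    using assms by simp
qed simp

end

section \<open>Laws of finite lists of i.i.d. steps\<close>

text \<open>Point masses on a countable type add up to one. This provides the joint law of a step
  pair, of which only the marginals are given as pmfs.\<close>

lemma (in prob_space) distr_countable_eq_pmf:
  fixes Z :: "'a \<Rightarrow> 's::countable"
  assumes [measurable]: "Z \<in> measurable M (count_space UNIV)"
  shows "\<exists>p. distr M (count_space UNIV) Z = measure_pmf p"
proof -
  define D where "D = distr M (count_space UNIV) Z"
  interpret D: prob_space D
    unfolding D_def by (rule prob_space_distr) measurable
  have sets: "sets D = UNIV" by (simp add: D_def)
  have "(\<integral>\<^sup>+z. ennreal (measure D {z}) \<partial>count_space UNIV) = (\<integral>\<^sup>+z. emeasure D {z} \<partial>count_space UNIV)"
    by (simp add: D.emeasure_eq_measure)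
  also have "\<dots> = emeasure D UNIV"
    by (rule emeasure_countable_singleton[symmetric]) (auto simp: sets)
  also have "\<dots> = 1"
    using D.emeasure_space_1 by (simp add: D_def)
  finally have pmf: "pmf (embed_pmf (\<lambda>z. measure D {z})) z = measure D {z}" for z
    by (intro pmf_embed_pmf) auto
  have "D = measure_pmf (embed_pmf (\<lambda>z. measure D {z}))"
    by (rule measure_eqI_countable[of _ UNIV])
       (auto simp: sets emeasure_pmf_single pmf D.emeasure_eq_measure)
  then show ?thesis unfolding D_def by blast
qed

lemma replicate_pmf_Suc_eq: "replicate_pmf (Suc n) p = bind_pmf p (\<lambda>x. map_pmf ((#) x) (replicate_pmf n p))"
  by (simp add: map_pmf_def)

lemma pmf_replicate_pmf:
  "pmf (replicate_pmf n p) l = (if length l = n then (\<Prod>i<n. pmf p (l ! i)) else 0)"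
proof (induction n arbitrary: l)
  case 0
  then show ?case by simp
next
  case (Suc n)
  show ?case
  proof (cases "length l = Suc n")
    case True
    then obtain x xs where l: "l = x # xs" by (cases l) auto
    have "replicate_pmf (Suc n) p = map_pmf (\<lambda>(x, xs). x # xs) (pair_pmf p (replicate_pmf n p))"
      by (simp add: pair_pmf_def map_pmf_def bind_assoc_pmf bind_return_pmf)
    then have "pmf (replicate_pmf (Suc n) p) l = pmf (pair_pmf p (replicate_pmf n p)) (x, xs)"
      using pmf_map_inj'[of "\<lambda>(x, xs). x # xs" _ "(x, xs)"] l by (simp add: inj_def)
    also have "\<dots> = pmf p x * (\<Prod>i<n. pmf p (xs ! i))"
      using True l by (simp add: pmf_pair Suc)
    also have "\<dots> = (\<Prod>i<Suc n. pmf p (l ! i))"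
      by (subst prod.lessThan_Suc_shift) (simp add: l)
    finally show ?thesis using True by simp
  next
    case False
    then have "l \<notin> set_pmf (replicate_pmf (Suc n) p)"
      unfolding set_replicate_pmf by simp
    then show ?thesis using False by (simp add: pmf_eq_0_set_pmf del: replicate_pmf.simps)
  qed
qed

text \<open>Lists over a countable type are countable, so point masses determine the law;
  independence makes each of them the product in \<open>pmf_replicate_pmf\<close>.\<close>

lemma (in prob_space) distr_iid_list:
  fixes Z :: "nat \<Rightarrow> 'a \<Rightarrow> 's::countable"
  assumes ind: "indep_vars (\<lambda>_. count_space UNIV) Z {1..}"
    and Z: "\<And>n. n \<ge> 1 \<Longrightarrow> distr M (count_space UNIV) (Z n) = measure_pmf p"
  defines "W n \<omega> \<equiv> map (\<lambda>i. Z i \<omega>) [1..<Suc n]"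
  shows "W n \<in> measurable M (count_space UNIV)"
    and "distr M (count_space UNIV) (W n) = measure_pmf (replicate_pmf n p)"
proof -
  have Zm: "Z i \<in> measurable M (count_space UNIV)" if "i \<ge> 1" for i
    using ind that unfolding indep_vars_def by auto
  have ev: "W n -` {l} \<inter> space M = (if length l = n then {\<omega>\<in>space M. \<forall>i\<in>{1..n}. Z i \<omega> = l ! (i - 1)} else {})" for l
  proof -
    have "W n \<omega> = l \<longleftrightarrow> length l = n \<and> (\<forall>i\<in>{1..n}. Z i \<omega> = l ! (i - 1))" for \<omega>
    proof -
      have "(\<forall>i\<in>{1..n}. Z i \<omega> = l ! (i - 1)) \<longleftrightarrow> (\<forall>i<n. Z (Suc i) \<omega> = l ! i)"
        unfolding image_Suc_lessThan[symmetric] by auto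
      then show ?thesis
        by (auto simp: W_def list_eq_iff_nth_eq simp del: upt_Suc)
    qed
    then show ?thesis by auto
  qed
  have evs: "{\<omega>\<in>space M. \<forall>i\<in>{1..n}. Z i \<omega> = l ! (i - 1)} \<in> sets M" for l
  proof (intro sets.sets_Collect_finite_All)
    fix i assume "i \<in> {1..n}"
    then have [measurable]: "Z i \<in> measurable M (count_space UNIV)" using Zm by simp
    show "{\<omega>\<in>space M. Z i \<omega> = l ! (i - 1)} \<in> sets M" by measurable
  qed simp
  show Wm: "W n \<in> measurable M (count_space UNIV)"
    by (subst measurable_count_space_eq2_countable) (simp_all add: ev evs del: One_nat_def)
  have "prob (W n -` {l} \<inter> space M) = pmf (replicate_pmf n p) l" for l
  proof (cases "length l = n \<and> n > 0")
    case True
    \<comment> \<open>For \<open>n = 0\<close> the intersection would be \<open>UNIV\<close> rather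
      than \<open>space M\<close>, so that case is treated apart.\<close>
    have "{\<omega>\<in>space M. \<forall>i\<in>{1..n}. Z i \<omega> = l ! (i - 1)} = (\<Inter>i\<in>{1..n}. Z i -` {l ! (i - 1)} \<inter> space M)"
      using True by auto
    then have "prob (W n -` {l} \<inter> space M) = (\<Prod>i\<in>{1..n}. prob (Z i -` {l ! (i - 1)} \<inter> space M))"
      using True indep_varsD[OF ind, of "{1..n}" "\<lambda>i. {l ! (i - 1)}"] by (simp add: ev)
    also have "\<dots> = (\<Prod>i\<in>{1..n}. pmf p (l ! (i - 1)))"
    proof (intro prod.cong refl)
      fix i assume "i \<in> {1..n}"
      then show "prob (Z i -` {l ! (i - 1)} \<inter> space M) = pmf p (l ! (i - 1))"
        using Z[of i] Zm[of i] measure_distr[of "Z i" M "count_space UNIV" "{l ! (i - 1)}"]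
        by (simp add: pmf.rep_eq)
    qed
    also have "\<dots> = (\<Prod>i<n. pmf p (l ! i))"
      by (rule prod.reindex_bij_witness[of _ Suc "\<lambda>i. i - 1"]) auto
    finally show ?thesis using True by (simp add: pmf_replicate_pmf)
  next
    case False
    then show ?thesis by (auto simp: ev pmf_replicate_pmf prob_space)
  qed
  then show "distr M (count_space UNIV) (W n) = measure_pmf (replicate_pmf n p)"
    by (intro measure_eqI_countable[of _ UNIV])
       (auto simp: emeasure_distr Wm emeasure_eq_measure emeasure_pmf_single)
qed

text \<open>Splitting off the first step reproduces the recursion of \<open>avoid\<close>: time one
  gives its case distinction, and the later times shift down by one.\<close>

lemma emeasure_replicate_avoid:
  "emeasure (replicate_pmf n p) {l. \<forall>i\<in>{1..n}. foldl step x (take i l) \<noteq> y} =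
     avoid (\<lambda>x. map_pmf (step x) p) y n x"
proof (induction n arbitrary: x)
  case 0
  then show ?case by (simp add: measure_pmf.emeasure_space_1[simplified])
next
  case (Suc n)
  have "(#) z -` {l. \<forall>i\<in>{1..Suc n}. foldl step x (take i l) \<noteq> y} =
      (if step x z = y then {} else {l. \<forall>i\<in>{1..n}. foldl step (step x z) (take i l) \<noteq> y})" for z
  proof -
    have "{1..Suc n} = insert 1 (Suc ` {1..n})"
      by (auto simp: image_Suc_atLeastAtMost)
    then have "(\<forall>i\<in>{1..Suc n}. P i) \<longleftrightarrow> P 1 \<and> (\<forall>i\<in>{1..n}. P (Suc i))" for P
      by (simp del: image_Suc_atLeastAtMost)
    then show ?thesis by auto
  qed
  then show ?case
    unfolding replicate_pmf_Suc_eq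
    by (auto simp: Suc simp del: One_nat_def intro!: nn_integral_cong)
qed

section \<open>Paths, return times and essential classes\<close>

lemma osc_walk_eq_foldl:
  "osc_walk \<xi> \<xi>' x n \<omega> = foldl osc_step x (map (\<lambda>i. (\<xi> i \<omega>, \<xi>' i \<omega>)) [1..<Suc n])"
proof (induction n)
  case (Suc n)
  then show ?case by (simp add: osc_step_def)
qed simp

text \<open>The tail events thus involve finitely many times only; paths without return belong to
  all of them, the infimum being \<open>\<infinity>\<close>.\<close>

lemma return_time_greater_iff: "enat n < return_time X x \<omega> \<longleftrightarrow> (\<forall>i\<in>{1..n}. X x i \<omega> \<noteq> x)"
proof -
  have "enat n < return_time X x \<omega> \<longleftrightarrow> (\<forall>i\<ge>1. X x i \<omega> = x \<longrightarrow> enat (Suc n) \<le> enat i)"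
    unfolding return_time_def Suc_ile_eq[symmetric] le_Inf_iff by blast
  then show ?thesis
    unfolding enat_ord_simps by (meson atLeastAtMost_iff not_less_eq_eq)
qed

text \<open>Since \<open>enat\<close> is countable, singletons suffice; each is a countable Boolean
  combination of tail events.\<close>

lemma measurable_return_time:
  assumes X: "\<And>n. {\<omega>\<in>space M. \<forall>i\<in>{1..n}. X x i \<omega> \<noteq> x} \<in> sets M"
  shows "return_time X x \<in> measurable M (count_space UNIV)"
proof -
  have gt: "{\<omega>\<in>space M. enat n < return_time X x \<omega>} \<in> sets M" for n
    using X by (simp add: return_time_greater_iff)
  have "return_time X x -` {e} \<inter> space M \<in> sets M" for e
  proof (cases e)
    case (enat n)
    have "return_time X x \<omega> = enat n \<longleftrightarrow>
        \<not> enat n < return_time X x \<omega> \<and> (\<forall>m<n. enat m < return_time X x \<omega>)" for \<omega>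
      by (cases "return_time X x \<omega>") (simp_all, metis linorder_neqE_nat less_irrefl)
    then have "return_time X x -` {e} \<inter> space M = {\<omega>\<in>space M. \<not> enat n < return_time X x \<omega>}
        \<inter> {\<omega>\<in>space M. \<forall>m\<in>{..<n}. enat m < return_time X x \<omega>}"
      by (auto simp: enat)
    moreover have "{\<omega>\<in>space M. \<not> enat n < return_time X x \<omega>} \<in> sets M"
      by (intro sets.sets_Collect_neg gt)
    moreover have "{\<omega>\<in>space M. \<forall>m\<in>{..<n}. enat m < return_time X x \<omega>} \<in> sets M"
      by (intro sets.sets_Collect_finite_All gt) simp
    ultimately show ?thesis by simp
  next
    case infinity
    have "return_time X x \<omega> = \<infinity> \<longleftrightarrow> (\<forall>m. enat m < return_time X x \<omega>)" for \<omega>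
      by (cases "return_time X x \<omega>") auto
    then have "return_time X x -` {e} \<inter> space M = {\<omega>\<in>space M. \<forall>m. enat m < return_time X x \<omega>}"
      by (auto simp: infinity)
    moreover have "\<dots> \<in> sets M"
      by (intro sets.sets_Collect_countable_All gt)
    ultimately show ?thesis by simp
  qed
  then show ?thesis
    by (subst measurable_count_space_eq2_countable) auto
qed

text \<open>A closed class contains the root, which is accessible from all its points; closedness
  and communication then leave only the set of states accessible from the root.\<close>

lemma essential_class_containing_root:
  assumes refl: "\<And>x. accessible M X x x"
    and trans: "\<And>x y z. accessible M X x y \<Longrightarrow> accessible M X y z \<Longrightarrow> accessible M X x z"
    and root: "\<And>x. accessible M X x r"
  shows "essential_class M X C \<longleftrightarrow> C = {y. accessible M X r y}"
proof
  assume C: "essential_class M X C"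
  then have "r \<in> C"
    using root unfolding essential_class_def by blast
  with C show "C = {y. accessible M X r y}"
    unfolding essential_class_def by blast
next
  assume C: "C = {y. accessible M X r y}"
  have "r \<in> C"
    using refl C by simp
  moreover have "accessible M X x y" if "x \<in> C" "y \<in> C" for x y
    using that trans[OF root] C by blast
  moreover have "y \<in> C" if "x \<in> C" "accessible M X x y" for x y
    using that trans C by blast
  ultimately show "essential_class M X C"
    unfolding essential_class_def by blast
qed

section \<open>The walk as a Markov chain on its probability space\<close>

text \<open>\<open>\<pi>\<close> is the joint law of a step pair and need not be a product.\<close>

locale osc_chain = prob_space M + opposite_jumps \<mu> \<mu>'
  for M :: "'w measure" and \<mu> \<mu>' +
  fixes \<xi> \<xi>' :: "nat \<Rightarrow> 'w \<Rightarrow> int" and \<pi> :: "(int \<times> int) pmf"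
  assumes indep: "indep_vars (\<lambda>_. count_space UNIV) (\<lambda>n \<omega>. (\<xi> n \<omega>, \<xi>' n \<omega>)) {1..}"
    and law: "n \<ge> 1 \<Longrightarrow> distr M (count_space UNIV) (\<lambda>\<omega>. (\<xi> n \<omega>, \<xi>' n \<omega>)) = measure_pmf \<pi>"
    and law_fst: "map_pmf fst \<pi> = \<mu>" and law_snd: "map_pmf snd \<pi> = \<mu>'"
begin

abbreviation X where "X \<equiv> osc_walk \<xi> \<xi>'"

definition steps where "steps n \<omega> = map (\<lambda>i. (\<xi> i \<omega>, \<xi>' i \<omega>)) [1..<Suc n]"

lemma measurable_steps [measurable]: "steps n \<in> measurable M (count_space UNIV)"
  and distr_steps: "distr M (count_space UNIV) (steps n) = measure_pmf (replicate_pmf n \<pi>)"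
  unfolding steps_def [abs_def]
  by (rule distr_iid_list[OF indep law]; simp)+

lemma emeasure_steps: "emeasure M {\<omega>\<in>space M. steps n \<omega> \<in> S} = emeasure (replicate_pmf n \<pi>) S"
  unfolding distr_steps[symmetric]
  by (subst emeasure_distr) (auto intro!: arg_cong[where f = "emeasure M"])

lemma X_eq: "i \<le> n \<Longrightarrow> X x i \<omega> = foldl osc_step x (take i (steps n \<omega>))"
  by (simp add: osc_walk_eq_foldl steps_def take_map del: upt_Suc)

lemma kernel_eq: "K = (\<lambda>x. map_pmf (osc_step x) \<pi>)"
proof
  fix x
  have "K x = (if x \<le> -1 then map_pmf (\<lambda>z. x + fst z) \<pi> else map_pmf (\<lambda>z. x + snd z) \<pi>)"
    by (simp add: osc_kernel_def law_fst[symmetric] law_snd[symmetric] pmf.map_comp o_def)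
  then show "K x = map_pmf (osc_step x) \<pi>"
    by (simp add: osc_step_def[abs_def])
qed

text \<open>A discrete law charges a set exactly when its support meets the set, and the support of
  \<open>replicate_pmf\<close> consists of lists over the support. Accessibility thus becomes a
  question about lists.\<close>

lemma accessible_iff:
  "accessible M X x y \<longleftrightarrow> (\<exists>l. set l \<subseteq> set_pmf \<pi> \<and> foldl osc_step x l = y)"
proof -
  have "measure M {\<omega>\<in>space M. X x n \<omega> = y} > 0 \<longleftrightarrow>
      (\<exists>l. set l \<subseteq> set_pmf \<pi> \<and> length l = n \<and> foldl osc_step x l = y)" for n
  proof -
    have "{\<omega>\<in>space M. X x n \<omega> = y} = {\<omega>\<in>space M. steps n \<omega> \<in> {l. foldl osc_step x (take n l) = y}}"
      using X_eq[of n n x] by simp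
    then have A: "measure M {\<omega>\<in>space M. X x n \<omega> = y} =
        measure (replicate_pmf n \<pi>) {l. foldl osc_step x (take n l) = y}"
      by (simp only: emeasure_steps measure_def)
    have B: "\<dots> > 0 \<longleftrightarrow> set_pmf (replicate_pmf n \<pi>) \<inter> {l. foldl osc_step x (take n l) = y} \<noteq> {}"
      unfolding measure_pmf_zero_iff[symmetric] by (simp add: zero_less_measure_iff)
    show ?thesis
      unfolding A B set_replicate_pmf by (auto simp: disjoint_iff lists_eq_set)
  qed
  then show ?thesis unfolding accessible_def by auto
qed

lemma accessible_refl: "accessible M X x x"
  unfolding accessible_iff by (intro exI[of _ "[]"]) simp

lemma accessible_trans:
  assumes "accessible M X x y" "accessible M X y z"
  shows "accessible M X x z"
proof -
  from assms obtain k l where "set k \<subseteq> set_pmf \<pi>" "foldl osc_step x k = y"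
      "set l \<subseteq> set_pmf \<pi>" "foldl osc_step y l = z"
    unfolding accessible_iff by blast
  then show ?thesis
    unfolding accessible_iff by (intro exI[of _ "k @ l"]) auto
qed

lemma set_\<mu>: "set_pmf \<mu> = fst ` set_pmf \<pi>" and set_\<mu>': "set_pmf \<mu>' = snd ` set_pmf \<pi>"
  by (simp_all flip: law_fst law_snd)

text \<open>A Gcd of one and jumps of both signs give a list with sum \<open>- x\<close> by
  \<open>int_sum_list_surj\<close>; \<open>osc_step_reaches_0\<close> orders it into a path.\<close>

lemma accessible_0:
  assumes "Gcd (set_pmf \<mu>) = 1"
  shows "accessible M X x 0"
proof -
  obtain s t where s: "s \<in> set_pmf \<mu>" and t: "t \<in> set_pmf \<mu>'"
    using set_pmf_not_empty[of \<mu>] set_pmf_not_empty[of \<mu>'] by auto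
  have "Gcd (set_pmf \<mu> \<union> set_pmf \<mu>') = 1"
  proof -
    have "Gcd (set_pmf \<mu> \<union> set_pmf \<mu>') dvd Gcd (set_pmf \<mu>)"
      by (rule Gcd_greatest) (rule Gcd_dvd, simp)
    then show ?thesis using assms by simp
  qed
  then obtain l where l: "set l \<subseteq> set_pmf \<mu> \<union> set_pmf \<mu>'" "sum_list l = - x"
    using int_sum_list_surj[of "set_pmf \<mu> \<union> set_pmf \<mu>'" s t "- x"] s t pos[OF s] neg[OF t] by auto
  have "\<exists>zs. set zs \<subseteq> set_pmf \<pi> \<and> foldl osc_step x zs = 0"
  proof (rule osc_step_reaches_0)
    show "x + sum_list l = 0" "set l \<subseteq> fst ` set_pmf \<pi> \<union> snd ` set_pmf \<pi>"
      using l by (simp_all add: set_\<mu> set_\<mu>')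
    show "fst z > 0" "snd z < 0" if "z \<in> set_pmf \<pi>" for z
      using that by (auto simp: set_\<mu> set_\<mu>' intro!: pos neg)
  qed
  then show ?thesis by (simp add: accessible_iff)
qed

text \<open>The support of the invariant measure contains \<open>0\<close> and is closed under the
  possible moves.\<close>

lemma accessible_flow_pos:
  assumes "accessible M X 0 y"
  shows "flow (indicator {y}) > 0"
proof -
  \<comment> \<open>the support of the invariant measure\<close>
  define D where "D x \<longleftrightarrow> (x \<ge> 0 \<and> (\<exists>k\<in>set_pmf \<mu>. x < k)) \<or> (x < 0 \<and> (\<exists>j\<in>set_pmf \<mu>'. j \<le> x))" for x
  have step: "D (osc_step x z)" if Dx: "D x" and z\<pi>: "z \<in> set_pmf \<pi>" for x z
  proof -
    have z: "fst z \<in> set_pmf \<mu>" "snd z \<in> set_pmf \<mu>'"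
      using z\<pi> by (auto simp: set_\<mu> set_\<mu>')
    then have "fst z > 0" "snd z < 0"
      using pos neg by auto
    show ?thesis
    proof (cases "x \<le> -1")
      case True
      then obtain j where j: "j \<in> set_pmf \<mu>'" "j \<le> x"
        using Dx by (auto simp: D_def)
      \<comment> \<open>If the walk crosses, the jump just made is the witness for \<open>D\<close>;
        otherwise \<open>j\<close> still is.\<close>
      have "j \<le> x + fst z" "x + fst z < fst z"
        using j True \<open>fst z > 0\<close> by auto
      with j(1) z(1) have "D (x + fst z)"
        unfolding D_def by (meson linorder_not_less)
      with True show ?thesis by (simp add: osc_step_def)
    next
      case False
      then obtain k where k: "k \<in> set_pmf \<mu>" "x < k"
        using Dx by (auto simp: D_def)
      have "x + snd z < k" "snd z \<le> x + snd z"
        using k False \<open>snd z < 0\<close> by auto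
      with k(1) z(2) have "D (x + snd z)"
        unfolding D_def by (meson linorder_not_less)
      with False show ?thesis by (simp add: osc_step_def)
    qed
  qed
  have "D (foldl osc_step x l)" if "D x" "set l \<subseteq> set_pmf \<pi>" for x l
    using that by (induction l arbitrary: x) (auto intro: step)
  moreover have "D 0"
    using set_pmf_not_empty[of \<mu>] pos by (auto simp: D_def)
  ultimately have "D y"
    using assms unfolding accessible_iff by blast
  then show ?thesis
    unfolding D_def by (rule flow_pos)
qed

lemma emeasure_return_time_greater:
  "{\<omega>\<in>space M. \<forall>i\<in>{1..n}. X y i \<omega> \<noteq> y} \<in> sets M"
  "emeasure M {\<omega>\<in>space M. enat n < return_time X y \<omega>} = avoid K y n y"
proof -
  have *: "{\<omega>\<in>space M. \<forall>i\<in>{1..n}. X y i \<omega> \<noteq> y} =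
      {\<omega>\<in>space M. steps n \<omega> \<in> {l. \<forall>i\<in>{1..n}. foldl osc_step y (take i l) \<noteq> y}}"
    using X_eq[of _ n y] by auto
  show "{\<omega>\<in>space M. \<forall>i\<in>{1..n}. X y i \<omega> \<noteq> y} \<in> sets M"
    unfolding * by measurable
  show "emeasure M {\<omega>\<in>space M. enat n < return_time X y \<omega>} = avoid K y n y"
    unfolding return_time_greater_iff * emeasure_steps emeasure_replicate_avoid kernel_eq ..
qed

text \<open>A path without return lies in every tail event, so the probability of such paths is at
  most the infimum of the tails, which \<open>avoid_tends_0\<close> makes zero.\<close>

lemma AE_return_time_finite:
  assumes "flow (K\<^sub>c (\<lambda>_. 1)) < \<infinity>" "flow (indicator {y}) > 0"
  shows "AE \<omega> in M. return_time X y \<omega> < \<infinity>"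
proof -
  have [measurable]: "return_time X y \<in> measurable M (count_space UNIV)"
    by (rule measurable_return_time emeasure_return_time_greater)+
  have "emeasure M {\<omega>\<in>space M. \<not> return_time X y \<omega> < \<infinity>} \<le> avoid K y n y" for n
    unfolding emeasure_return_time_greater(2)[symmetric]
    by (intro emeasure_mono) auto
  then have "emeasure M {\<omega>\<in>space M. \<not> return_time X y \<omega> < \<infinity>} \<le> (INF n. avoid K y n y)"
    by (intro INF_greatest)
  then have "emeasure M {\<omega>\<in>space M. \<not> return_time X y \<omega> < \<infinity>} = 0"
    using avoid_tends_0[OF assms] by simp
  then show ?thesis
    by (subst AE_iff_measurable[OF _ refl]) auto
qed

text \<open>The expectation is the sum of the tail probabilities, that is, of
  \<open>avoid K y n y\<close>.\<close>

lemma expected_return_time_finite: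
  assumes "flow (\<lambda>_. 1) < \<infinity>" "flow (indicator {y}) > 0"
  shows "(\<integral>\<^sup>+\<omega>. ennreal_of_enat (return_time X y \<omega>) \<partial>M) < \<infinity>"
proof -
  have "return_time X y \<in> measurable M (count_space UNIV)"
    by (rule measurable_return_time emeasure_return_time_greater)+
  then show ?thesis
    using avoid_sum_finite[OF assms]
    by (simp add: nn_integral_enat_function emeasure_return_time_greater)
qed

end

section \<open>Transfer of the moments to the laws, and conclusion\<close>

lemma nn_integral_law_finite:
  fixes Y :: "'w \<Rightarrow> 's" and p :: "'s pmf" and f :: "'s \<Rightarrow> real"
  assumes "distr M (count_space UNIV) Y = measure_pmf p" "Y \<in> measurable M (count_space UNIV)"
    and "integrable M (\<lambda>\<omega>. f (Y \<omega>))"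
  shows "(\<integral>\<^sup>+k. ennreal \<bar>f k\<bar> \<partial>p) < \<infinity>"
  using assms(3) unfolding assms(1)[symmetric]
  by (subst nn_integral_distr) (use assms(2) in \<open>auto simp: integrable_iff_bounded\<close>)

theorem corollary4p4:
  fixes \<mu> \<mu>' :: "int pmf"
    and M :: "'w measure"
    and \<xi> \<xi>' :: "nat \<Rightarrow> 'w \<Rightarrow> int"
    and p q :: real
  assumes "set_pmf \<mu> \<subseteq> {k. k > 0}"
    and "set_pmf \<mu>' \<subseteq> {k. k < 0}"
    and "Gcd (set_pmf \<mu>) = 1"
    and "Gcd (set_pmf \<mu>') = 1"
    and "iid_steps M \<mu> \<mu>' \<xi> \<xi>'"
    and "0 < p" and "p < 1" and "0 < q" and "q < 1" and "p + q = 1"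
    and "integrable M (\<lambda>\<omega>. real_of_int (\<xi> 1 \<omega>) powr p)"
    and "integrable M (\<lambda>\<omega>. real_of_int (- \<xi>' 1 \<omega>) powr q)"
  shows "summable (\<lambda>n::nat. measure_pmf.prob \<mu> {int n<..} * measure_pmf.prob \<mu>' {..<- int n}) \<and>
    (\<exists>!C. essential_class M (osc_walk \<xi> \<xi>') C) \<and>
    (\<forall>C. essential_class M (osc_walk \<xi> \<xi>') C \<longrightarrow>
       recurrent_on M (osc_walk \<xi> \<xi>') C \<and>
       (integrable M (\<lambda>\<omega>. real_of_int (\<xi> 1 \<omega>)) \<and>
        integrable M (\<lambda>\<omega>. real_of_int (- \<xi>' 1 \<omega>)) \<longrightarrow>
        positive_recurrent_on M (osc_walk \<xi> \<xi>') C))"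
proof -
  from assms(5) interpret prob_space M
    by (simp add: iid_steps_def)
  let ?Z = "\<lambda>n \<omega>. (\<xi> n \<omega>, \<xi>' n \<omega>)"
  have indep: "indep_vars (\<lambda>_. count_space UNIV) ?Z {1..}"
    and laws: "distr M (count_space UNIV) (\<xi> 1) = measure_pmf \<mu>"
      "distr M (count_space UNIV) (\<xi>' 1) = measure_pmf \<mu>'"
    using assms(5) by (simp_all add: iid_steps_def)
  have Z: "?Z 1 \<in> measurable M (count_space UNIV)"
    using indep unfolding indep_vars_def by auto
  have meas: "\<xi> 1 \<in> measurable M (count_space UNIV)" "\<xi>' 1 \<in> measurable M (count_space UNIV)"
    using measurable_compose[OF Z, of fst] measurable_compose[OF Z, of snd] by simp_all
  \<comment> \<open>The joint law is not among the data; it is read off from the first pair.\<close>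
  obtain \<pi> where \<pi>: "distr M (count_space UNIV) (?Z 1) = measure_pmf \<pi>"
    using distr_countable_eq_pmf[OF Z] by blast
  have proj: "map_pmf f \<pi> = p" if "distr M (count_space UNIV) (\<lambda>\<omega>. f (?Z 1 \<omega>)) = measure_pmf p"
    for f and p :: "int pmf"
  proof -
    have "measure_pmf (map_pmf f \<pi>) = distr (distr M (count_space UNIV) (?Z 1)) (count_space UNIV) f"
      by (simp only: map_pmf_rep_eq \<pi>)
    also have "\<dots> = distr M (count_space UNIV) (f \<circ> ?Z 1)"
      by (rule distr_distr) (use Z in simp_all)
    finally show ?thesis
      using that by (simp add: o_def measure_pmf_inject)
  qed
  interpret osc_chain M \<mu> \<mu>' \<xi> \<xi>' \<pi>
  proof unfold_locales
    show "distr M (count_space UNIV) (?Z n) = measure_pmf \<pi>" if "n \<ge> 1" for n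
      using assms(5) \<pi> that unfolding iid_steps_def by metis
    show "map_pmf fst \<pi> = \<mu>" "map_pmf snd \<pi> = \<mu>'"
      using laws by (auto intro!: proj)
  qed (use assms(1,2) indep in auto)
  have "(\<integral>\<^sup>+k. ennreal (real_of_int k powr p) \<partial>\<mu>) < \<infinity>"
    using nn_integral_law_finite[OF laws(1) meas(1), of "\<lambda>k. real_of_int k powr p"] assms(11) by simp
  moreover have "(\<integral>\<^sup>+k. ennreal (real_of_int (- k) powr q) \<partial>\<mu>') < \<infinity>"
    using nn_integral_law_finite[OF laws(2) meas(2), of "\<lambda>k. real_of_int (- k) powr q"] assms(12) by simp
  ultimately have min: "(\<integral>\<^sup>+k. \<integral>\<^sup>+j. of_nat (nat (min k (- j))) \<partial>\<mu>' \<partial>\<mu>) < \<infinity>"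
    using assms(6,8,10) by (intro min_finite[of p q]) auto
  then have cross: "flow (K\<^sub>c (\<lambda>_. 1)) < \<infinity>"
    by (intro le_less_trans[OF flow_crossing_le]) (simp add: ennreal_mult_less_top)
  \<comment> \<open>Every state leads to \<open>0\<close>, which therefore serves as the root of the
    only essential class.\<close>
  have ess: "essential_class M X C \<longleftrightarrow> C = {y. accessible M X 0 y}" for C
    by (intro essential_class_containing_root accessible_refl accessible_0 assms(3))
       (rule accessible_trans)
  have "positive_recurrent_on M X {y. accessible M X 0 y}"
    if "integrable M (\<lambda>\<omega>. real_of_int (\<xi> 1 \<omega>))" "integrable M (\<lambda>\<omega>. real_of_int (- \<xi>' 1 \<omega>))"
  proof -
    have "(\<integral>\<^sup>+k. of_nat (nat k) \<partial>\<mu>) \<le> (\<integral>\<^sup>+k. ennreal \<bar>real_of_int k\<bar> \<partial>\<mu>)"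
      by (intro nn_integral_mono) (auto simp: ennreal_of_nat_eq_real_of_nat intro!: ennreal_leI)
    also have "\<dots> < \<infinity>"
      using nn_integral_law_finite[OF laws(1) meas(1)] that(1) by simp
    finally have 1: "(\<integral>\<^sup>+k. of_nat (nat k) \<partial>\<mu>) < \<infinity>" .
    have "(\<integral>\<^sup>+k. of_nat (nat (- k)) \<partial>\<mu>') \<le> (\<integral>\<^sup>+k. ennreal \<bar>real_of_int (- k)\<bar> \<partial>\<mu>')"
      by (intro nn_integral_mono) (auto simp: ennreal_of_nat_eq_real_of_nat intro!: ennreal_leI)
    also have "\<dots> < \<infinity>"
      using nn_integral_law_finite[OF laws(2) meas(2), of "\<lambda>k. real_of_int (- k)"] that(2) by simp
    finally have 2: "(\<integral>\<^sup>+k. of_nat (nat (- k)) \<partial>\<mu>') < \<infinity>" .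
    from 1 2 have "flow (\<lambda>_. 1) < \<infinity>" by (simp add: flow_1)
    then show ?thesis
      unfolding positive_recurrent_on_def
      by (auto intro!: expected_return_time_finite[simplified] accessible_flow_pos)
  qed
  moreover have "recurrent_on M X {y. accessible M X 0 y}"
    unfolding recurrent_on_def
    using AE_return_time_finite[OF cross accessible_flow_pos] by blast
  ultimately show ?thesis
    using tails_summable[OF min] by (auto simp: ess)
qed

end
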